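(* Every finite coloured string $A$ has a substring $B$ such that $B\equiv_2 A$ and $B$ is $\equiv_2$-optimal.
   Context: A finite coloured string is a finite coloured linear order, i.e. a triple $(A,<,F)$ where $(A,<)$ is a finite linear order and $F$ is a map from $A$ onto a finite set of colours; its length is $|A|$. A substring of $A$ is a subordering: a subset of $A$ with the induced order and colouring (not necessarily a set of consecutive points). In the $n$-move Ehrenfeucht-Fraïssé game on coloured linear orders $A$ and $B$, players I and II move alternately, I first; on each move I picks an element of either structure and II responds with an element of the other structure. After $n$ moves elements $a_1,\dots,a_n\in A$ and $b_1,\dots,b_n\in B$ have been chosen, and II wins if $a_i\mapsto b_i$ is an order- and colour-isomorphism. $A\equiv_n B$ means that II has a winning strategy. A finite coloured linear order is $\equiv_n$-optimal if no coloured linear order of smaller length is $n$-equivalent to it. *)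

theory Defs
  imports Main
begin

text \<open>
  A coloured order \<open>(A,<,F)\<close>. Only the values of the order and of the colouring on
  \<open>points\<close> are relevant. Two orders to be compared share the type of colours, but not
  the type of points.
\<close>

record ('a, 'c) coloured_order =
  points :: "'a set"
  lt :: "'a \<Rightarrow> 'a \<Rightarrow> bool"
  col :: "'a \<Rightarrow> 'c"

definition coloured_linear_order :: "('a, 'c) coloured_order \<Rightarrow> bool" where
  "coloured_linear_order A \<longleftrightarrow>
     irreflp_on (points A) (lt A) \<and> transp_on (points A) (lt A) \<and> totalp_on (points A) (lt A) \<and>
     finite (col A ` points A)"

definition finite_coloured_string :: "('a, 'c) coloured_order \<Rightarrow> bool" where
  "finite_coloured_string A \<longleftrightarrow> coloured_linear_order A \<and> finite (points A)"

abbreviation string_length :: "('a, 'c) coloured_order \<Rightarrow> nat" where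
  "string_length A \<equiv> card (points A)"

definition substring :: "('a, 'c) coloured_order \<Rightarrow> ('a, 'c) coloured_order \<Rightarrow> bool" where
  "substring B A \<longleftrightarrow>
     points B \<subseteq> points A \<and>
     (\<forall>x\<in>points B. \<forall>y\<in>points B. lt B x y \<longleftrightarrow> lt A x y) \<and>
     (\<forall>x\<in>points B. col B x = col A x)"

text \<open>
  A position of the Ehrenfeucht-Fraisse game on \<open>A\<close> and \<open>B\<close> is the list of the pairs
  \<open>(a\<^sub>i, b\<^sub>i)\<close> chosen so far. The first conjunct below says that \<open>a\<^sub>i \<mapsto> b\<^sub>i\<close> is a
  well-defined injective map.
\<close>

definition order_colour_iso ::
  "('a, 'c) coloured_order \<Rightarrow> ('b, 'c) coloured_order \<Rightarrow> ('a \<times> 'b) list \<Rightarrow> bool" where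
  "order_colour_iso A B ps \<longleftrightarrow>
     (\<forall>(a, b)\<in>set ps. \<forall>(a', b')\<in>set ps.
        (a = a' \<longleftrightarrow> b = b') \<and> (lt A a a' \<longleftrightarrow> lt B b b')) \<and>
     (\<forall>(a, b)\<in>set ps. col A a = col B b)"

text \<open>
  A strategy of player II is a pair \<open>f\<close>, \<open>g\<close>: in the position \<open>ps\<close>, II answers a point \<open>a\<close>
  of \<open>A\<close> by \<open>f ps a\<close> and a point \<open>b\<close> of \<open>B\<close> by \<open>g ps b\<close>. The set \<open>plays A B f g\<close> consists of
  all positions that can arise, over all choices of player I, when II follows the strategy.
\<close>

inductive_set plays ::
  "('a, 'c) coloured_order \<Rightarrow> ('b, 'c) coloured_order \<Rightarrow>
   (('a \<times> 'b) list \<Rightarrow> 'a \<Rightarrow> 'b) \<Rightarrow> (('a \<times> 'b) list \<Rightarrow> 'b \<Rightarrow> 'a) \<Rightarrow> ('a \<times> 'b) list set"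
  for A B f g where
  start: "[] \<in> plays A B f g"
| pick_left: "ps \<in> plays A B f g \<Longrightarrow> a \<in> points A \<Longrightarrow> ps @ [(a, f ps a)] \<in> plays A B f g"
| pick_right: "ps \<in> plays A B f g \<Longrightarrow> b \<in> points B \<Longrightarrow> ps @ [(g ps b, b)] \<in> plays A B f g"

text \<open>
  In the first \<open>n\<close> rounds the answers must be legal moves; in particular II loses if I picks a
  point and the other structure is empty.
\<close>

definition winning_strategy ::
  "nat \<Rightarrow> ('a, 'c) coloured_order \<Rightarrow> ('b, 'c) coloured_order \<Rightarrow>
   (('a \<times> 'b) list \<Rightarrow> 'a \<Rightarrow> 'b) \<Rightarrow> (('a \<times> 'b) list \<Rightarrow> 'b \<Rightarrow> 'a) \<Rightarrow> bool" where
  "winning_strategy n A B f g \<longleftrightarrow>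
     (\<forall>ps\<in>plays A B f g. length ps < n \<longrightarrow>
        (\<forall>a\<in>points A. f ps a \<in> points B) \<and> (\<forall>b\<in>points B. g ps b \<in> points A)) \<and>
     (\<forall>ps\<in>plays A B f g. length ps = n \<longrightarrow> order_colour_iso A B ps)"

definition ef_equiv ::
  "nat \<Rightarrow> ('a, 'c) coloured_order \<Rightarrow> ('b, 'c) coloured_order \<Rightarrow> bool" where
  "ef_equiv n A B \<longleftrightarrow> (\<exists>f g. winning_strategy n A B f g)"

text \<open>
  The competing orders \<open>C\<close> are taken with points in \<^typ>\<open>nat\<close>, since a definition cannot
  quantify over types. As they are finite this is no restriction: see \<open>ef_optimal_any_type\<close>.
\<close>

definition ef_optimal :: "nat \<Rightarrow> ('a, 'c) coloured_order \<Rightarrow> bool" where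
  "ef_optimal n A \<longleftrightarrow>
     finite_coloured_string A \<and>
     (\<forall>C :: (nat, 'c) coloured_order.
        finite_coloured_string C \<and> string_length C < string_length A \<longrightarrow> \<not> ef_equiv n C A)"

lemma order_colour_isoD:
  assumes "order_colour_iso A B ps" "(a, b) \<in> set ps" "(a', b') \<in> set ps"
  shows "(a = a' \<longleftrightarrow> b = b') \<and> (lt A a a' \<longleftrightarrow> lt B b b') \<and> col A a = col B b"
proof -
  from assms(1) have 1: "\<forall>p\<in>set ps. \<forall>q\<in>set ps.
      (fst p = fst q \<longleftrightarrow> snd p = snd q) \<and> (lt A (fst p) (fst q) \<longleftrightarrow> lt B (snd p) (snd q))"
    and 2: "\<forall>p\<in>set ps. col A (fst p) = col B (snd p)"
    unfolding order_colour_iso_def case_prod_beta by blast+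
  from bspec[OF bspec[OF 1 assms(2)] assms(3)] bspec[OF 2 assms(2)] show ?thesis by simp
qed

lemma ef_optimal_any_type:
  fixes A :: "('a, 'c) coloured_order" and C :: "('b, 'c) coloured_order"
  assumes opt: "ef_optimal n A" and C: "finite_coloured_string C"
    and less: "string_length C < string_length A"
  shows "\<not> ef_equiv n C A"
proof
  assume "ef_equiv n C A"
  then obtain f g where win: "winning_strategy n C A f g"
    unfolding ef_equiv_def by blast
  from C have fin: "finite (points C)" by (simp add: finite_coloured_string_def)
  then obtain h :: "'b \<Rightarrow> nat" where h: "inj_on h (points C)"
    using finite_imp_inj_to_nat_seg by blast
  define k where "k = inv_into (points C) h"
  have kh: "k (h x) = x" if "x \<in> points C" for x
    using that h by (simp add: k_def)
  define C' :: "(nat, 'c) coloured_order" where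
    "C' = \<lparr>points = h ` points C, lt = (\<lambda>x y. lt C (k x) (k y)), col = (\<lambda>x. col C (k x))\<rparr>"
  have "col C' ` points C' = col C ` points C"
    by (simp add: C'_def image_image kh)
  moreover have "irreflp_on (points C') (lt C')"
    using C unfolding finite_coloured_string_def coloured_linear_order_def C'_def
    by (simp add: irreflp_on_def kh)
  moreover have "transp_on (points C') (lt C')"
  proof (rule transp_onI)
    fix x y z assume "x \<in> points C'" "y \<in> points C'" "z \<in> points C'" "lt C' x y" "lt C' y z"
    moreover have "transp_on (points C) (lt C)"
      using C by (simp add: finite_coloured_string_def coloured_linear_order_def)
    ultimately show "lt C' x z"
      unfolding C'_def by (auto simp: kh elim: transp_onD)
  qed
  moreover have "totalp_on (points C') (lt C')"
  proof (rule totalp_onI)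
    fix x y assume "x \<in> points C'" "y \<in> points C'" "x \<noteq> y"
    then obtain u v where "u \<in> points C" "v \<in> points C" "x = h u" "y = h v" "u \<noteq> v"
      by (auto simp: C'_def)
    then show "lt C' x y \<or> lt C' y x"
      using C unfolding finite_coloured_string_def coloured_linear_order_def totalp_on_def
      by (simp add: C'_def kh)
  qed
  ultimately have C': "finite_coloured_string C'"
    using C by (simp add: finite_coloured_string_def coloured_linear_order_def) (simp add: C'_def)
  have card: "string_length C' = string_length C"
    by (simp add: C'_def card_image h)
  define m where "m = map (map_prod k (\<lambda>y::'a. y))"
  define f' where "f' = (\<lambda>ps x. f (m ps) (k x))"
  define g' where "g' = (\<lambda>ps y. h (g (m ps) y))"
  have legal: "f ps a \<in> points A"
    if "ps \<in> plays C A f g" "length ps < n" "a \<in> points C" for ps a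
    using win that unfolding winning_strategy_def by blast
  have legal2: "g ps b \<in> points C"
    if "ps \<in> plays C A f g" "length ps < n" "b \<in> points A" for ps b
    using win that unfolding winning_strategy_def by blast
  have pl: "length ps \<le> n \<longrightarrow> m ps \<in> plays C A f g \<and> fst ` set ps \<subseteq> points C'"
    if "ps \<in> plays C' A f' g'" for ps
    using that
  proof induction
    case start
    then show ?case by (simp add: m_def plays.start)
  next
    case (pick_left ps a)
    show ?case
    proof
      assume len: "length (ps @ [(a, f' ps a)]) \<le> n"
      with pick_left have "m ps \<in> plays C A f g" and "fst ` set ps \<subseteq> points C'" by auto
      moreover from pick_left have "k a \<in> points C" by (auto simp: C'_def kh)
      moreover have "m (ps @ [(a, f' ps a)]) = m ps @ [(k a, f (m ps) (k a))]"
        by (simp add: m_def f'_def)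
      ultimately show "m (ps @ [(a, f' ps a)]) \<in> plays C A f g \<and>
          fst ` set (ps @ [(a, f' ps a)]) \<subseteq> points C'"
        using pick_left by (auto intro: plays.pick_left)
    qed
  next
    case (pick_right ps b)
    show ?case
    proof
      assume len: "length (ps @ [(g' ps b, b)]) \<le> n"
      with pick_right have p: "m ps \<in> plays C A f g" and s: "fst ` set ps \<subseteq> points C'" by auto
      have "length (m ps) < n" using len by (simp add: m_def)
      with p pick_right have gC: "g (m ps) b \<in> points C" by (blast intro: legal2)
      then have "m (ps @ [(g' ps b, b)]) = m ps @ [(g (m ps) b, b)]"
        by (simp add: m_def g'_def kh)
      then show "m (ps @ [(g' ps b, b)]) \<in> plays C A f g \<and>
          fst ` set (ps @ [(g' ps b, b)]) \<subseteq> points C'"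
        using p s gC pick_right by (auto simp: g'_def C'_def intro: plays.pick_right)
    qed
  qed
  have len_m: "length (m ps) = length ps" for ps by (simp add: m_def)
  have iso: "order_colour_iso C' A ps"
    if "order_colour_iso C A (m ps)" "fst ` set ps \<subseteq> points C'" for ps
  proof -
    have k_eq: "k a = k a' \<longleftrightarrow> a = a'" if "a \<in> points C'" "a' \<in> points C'" for a a'
      using that by (auto simp: C'_def kh)
    have in_C': "a \<in> points C'" if "(a, b) \<in> set ps" for a b
      using that \<open>fst ` set ps \<subseteq> points C'\<close> by force
    have mem: "(k a, b) \<in> set (m ps)" if "(a, b) \<in> set ps" for a b
      using that by (force simp: m_def)
    have pair: "(a = a' \<longleftrightarrow> b = b') \<and> (lt C' a a' \<longleftrightarrow> lt A b b') \<and> col C' a = col A b"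
      if "(a, b) \<in> set ps" "(a', b') \<in> set ps" for a b a' b'
    proof -
      have "(k a = k a' \<longleftrightarrow> b = b') \<and> (lt C (k a) (k a') \<longleftrightarrow> lt A b b') \<and> col C (k a) = col A b"
        using \<open>order_colour_iso C A (m ps)\<close> mem[OF that(1)] mem[OF that(2)]
        by (rule order_colour_isoD)
      then show ?thesis
        using k_eq[OF in_C'[OF that(1)] in_C'[OF that(2)]] by (simp add: C'_def)
    qed
    show ?thesis
      unfolding order_colour_iso_def by (intro conjI ballI) (auto dest: pair)
  qed
  have "winning_strategy n C' A f' g'"
    unfolding winning_strategy_def
  proof (intro conjI ballI impI)
    fix ps a assume "ps \<in> plays C' A f' g'" "length ps < n" "a \<in> points C'"
    then show "f' ps a \<in> points A"
      using pl[of ps] len_m[of ps] legal[of "m ps" "k a"]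
      by (auto simp: f'_def C'_def kh)
  next
    fix ps b assume "ps \<in> plays C' A f' g'" "length ps < n" "b \<in> points A"
    then show "g' ps b \<in> points C'"
      using pl[of ps] len_m[of ps] legal2[of "m ps" b]
      by (auto simp: g'_def C'_def)
  next
    fix ps assume "ps \<in> plays C' A f' g'" "length ps = n"
    then show "order_colour_iso C' A ps"
      using pl[of ps] len_m[of ps] win iso unfolding winning_strategy_def by auto
  qed
  with opt C' card less show False
    unfolding ef_optimal_def ef_equiv_def by auto
qed

end

theory Submission
  imports Defs
begin

text \<open>
  Call the colour of a point, together with the set of colours strictly below it and the set of
  colours strictly above it, the \<^emph>\<open>type\<close> of the point. With one round left after a first
  exchange \<open>(a, b)\<close>, player II survives exactly if \<open>a\<close> and \<open>b\<close> have the same type. Hence two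
  linear orders are 2-equivalent iff they realise the same types
  (\<open>ef_equiv_2_if_types_eq\<close>, \<open>types_subset_if_ef_equiv_2\<close>), and every order that is
  2-equivalent to \<open>A\<close> has at least as many points as \<open>A\<close> has types.

  This bound is attained by a substring of \<open>A\<close>: take one point of each type. The danger is that
  the points which remain have smaller sets of colours below and above them than before. That does
  not happen, because the first and the last point of a given colour share their type
  with no other point of \<open>A\<close>, so they are selected whatever choice of representatives is made.
  A colour occurs below \<open>x\<close> iff its first point is below \<open>x\<close>, and above \<open>x\<close> iff its
  last point is above \<open>x\<close>, so types in the substring agree with types in \<open>A\<close>
  (\<open>point_type_restrict\<close>).
\<close>

section \<open>Types of points\<close>

definition point_type :: "('a, 'c) coloured_order \<Rightarrow> 'a \<Rightarrow> 'c \<times> 'c set \<times> 'c set" where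
  "point_type A x =
     (col A x, col A ` {y \<in> points A. lt A y x}, col A ` {y \<in> points A. lt A x y})"

lemma order_colour_iso_pair:
  assumes "coloured_linear_order A" "coloured_linear_order B"
    and "a \<in> points A" "a' \<in> points A" "b \<in> points B" "b' \<in> points B"
  shows "order_colour_iso A B [(a, b), (a', b')] \<longleftrightarrow>
    (a = a' \<longleftrightarrow> b = b') \<and> (lt A a a' \<longleftrightarrow> lt B b b') \<and> (lt A a' a \<longleftrightarrow> lt B b' b) \<and>
    col A a = col B b \<and> col A a' = col B b'"
proof -
  have "\<not> lt A a a" "\<not> lt A a' a'" "\<not> lt B b b" "\<not> lt B b' b'"
    using assms by (simp_all add: coloured_linear_order_def irreflp_on_def)
  then show ?thesis unfolding order_colour_iso_def by auto
qed

lemma coloured_linear_order_asym: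
  assumes "coloured_linear_order A" "x \<in> points A" "y \<in> points A" "lt A x y"
  shows "\<not> lt A y x"
  using assms unfolding coloured_linear_order_def irreflp_on_def transp_on_def by blast

lemma coloured_linear_order_total:
  assumes "coloured_linear_order A" "x \<in> points A" "y \<in> points A"
  shows "x = y \<or> lt A x y \<or> lt A y x"
  using assms unfolding coloured_linear_order_def totalp_on_def by blast

section \<open>2-equivalence and types\<close>

text \<open>
  The back-and-forth principle: II wins by preserving an invariant \<open>Q\<close> of positions, answering
  every move with some point that restores it.
\<close>

lemma ef_equiv_if_back_and_forth:
  assumes start: "Q []"
    and forth_step: "\<And>ps a. Q ps \<Longrightarrow> length ps < n \<Longrightarrow> a \<in> points A \<Longrightarrow>
      \<exists>b\<in>points B. Q (ps @ [(a, b)])"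
    and back_step: "\<And>ps b. Q ps \<Longrightarrow> length ps < n \<Longrightarrow> b \<in> points B \<Longrightarrow>
      \<exists>a\<in>points A. Q (ps @ [(a, b)])"
    and iso: "\<And>ps. Q ps \<Longrightarrow> length ps = n \<Longrightarrow> order_colour_iso A B ps"
  shows "ef_equiv n A B"
proof -
  define f where "f ps a = (SOME b. b \<in> points B \<and> Q (ps @ [(a, b)]))" for ps a
  define g where "g ps b = (SOME a. a \<in> points A \<and> Q (ps @ [(a, b)]))" for ps b
  have f: "f ps a \<in> points B \<and> Q (ps @ [(a, f ps a)])"
    if "Q ps" "length ps < n" "a \<in> points A" for ps a
    using forth_step[OF that] unfolding f_def Bex_def by (rule someI_ex)
  have g: "g ps b \<in> points A \<and> Q (ps @ [(g ps b, b)])"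
    if "Q ps" "length ps < n" "b \<in> points B" for ps b
    using back_step[OF that] unfolding g_def Bex_def by (rule someI_ex)
  have inv: "length ps \<le> n \<longrightarrow> Q ps" if "ps \<in> plays A B f g" for ps
    using that by induction (auto simp: start f g)
  have "winning_strategy n A B f g"
    unfolding winning_strategy_def using inv f g iso by auto
  then show ?thesis unfolding ef_equiv_def by blast
qed

text \<open>
  The second round: the colour sets in the type of \<open>b\<close> record precisely which challenges on
  either side of \<open>a\<close> can be met on the same side of \<open>b\<close>.
\<close>

lemma reply_if_point_type_eq:
  assumes lin: "coloured_linear_order A" "coloured_linear_order B"
    and pts: "a \<in> points A" "b \<in> points B" "a' \<in> points A"
    and eq: "point_type A a = point_type B b"
  shows "\<exists>b'\<in>points B. order_colour_iso A B [(a, b), (a', b')]"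
proof -
  have irr: "\<not> lt A a a" "\<not> lt B b b"
    using lin pts unfolding coloured_linear_order_def by (auto dest: irreflp_onD)
  consider "a' = a" | "lt A a' a" | "lt A a a'"
    using coloured_linear_order_total[OF lin(1) pts(3,1)] by blast
  then show ?thesis
  proof cases
    case 1
    then show ?thesis
      using eq pts irr by (auto simp: order_colour_iso_pair[OF lin] point_type_def)
  next
    case 2
    then have "col A a' \<in> col B ` {y \<in> points B. lt B y b}"
      using eq pts by (auto simp: point_type_def)
    then obtain b' where b': "b' \<in> points B" "lt B b' b" "col A a' = col B b'" by blast
    have "\<not> lt A a a'" "\<not> lt B b b'"
      using coloured_linear_order_asym[OF lin(1) pts(3) pts(1)]
        coloured_linear_order_asym[OF lin(2) b'(1) pts(2)] 2 b'(2)
      by simp_all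
    moreover have "a \<noteq> a'" "b \<noteq> b'" using irr 2 b' by auto
    moreover have "col A a = col B b" using eq by (simp add: point_type_def)
    ultimately show ?thesis
      using 2 b' pts by (intro bexI[of _ b']) (simp_all add: order_colour_iso_pair[OF lin])
  next
    case 3
    then have "col A a' \<in> col B ` {y \<in> points B. lt B b y}"
      using eq pts by (auto simp: point_type_def)
    then obtain b' where b': "b' \<in> points B" "lt B b b'" "col A a' = col B b'" by blast
    have "\<not> lt A a' a" "\<not> lt B b' b"
      using coloured_linear_order_asym[OF lin(1) pts(1) pts(3)]
        coloured_linear_order_asym[OF lin(2) pts(2) b'(1)] 3 b'(2)
      by simp_all
    moreover have "a \<noteq> a'" "b \<noteq> b'" using irr 3 b' by auto
    moreover have "col A a = col B b" using eq by (simp add: point_type_def)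
    ultimately show ?thesis
      using 3 b' pts by (intro bexI[of _ b']) (simp_all add: order_colour_iso_pair[OF lin])
  qed
qed

lemma ef_equiv_2_if_types_eq:
  assumes lin: "coloured_linear_order A" "coloured_linear_order B"
    and types: "point_type A ` points A = point_type B ` points B"
  shows "ef_equiv 2 A B"
proof -
  \<comment> \<open>The invariant: after one round the two chosen points have the same type.\<close>
  define Q where "Q ps \<longleftrightarrow> ps = [] \<or>
      (\<exists>a\<in>points A. \<exists>b\<in>points B. ps = [(a, b)] \<and> point_type A a = point_type B b) \<or>
      length ps = 2 \<and> order_colour_iso A B ps" for ps
  have short: "ps = [] \<or>
      (\<exists>a\<in>points A. \<exists>b\<in>points B. ps = [(a, b)] \<and> point_type A a = point_type B b)"
    if "Q ps" "length ps < 2" for ps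
    using that unfolding Q_def by auto
  show ?thesis
  proof (rule ef_equiv_if_back_and_forth[of Q])
    show "Q []" by (simp add: Q_def)
  next
    fix ps a assume Q: "Q ps" "length ps < 2" and a: "a \<in> points A"
    from short[OF Q] show "\<exists>b\<in>points B. Q (ps @ [(a, b)])"
    proof (elim disjE bexE conjE)
      assume ps: "ps = []"
      from a have "point_type A a \<in> point_type B ` points B" using types by blast
      then show ?thesis using ps a unfolding Q_def by auto
    next
      fix a0 b0
      assume "a0 \<in> points A" "b0 \<in> points B" "ps = [(a0, b0)]"
        "point_type A a0 = point_type B b0"
      then show ?thesis using reply_if_point_type_eq[OF lin _ _ a] unfolding Q_def by fastforce
    qed
  next
    fix ps b assume Q: "Q ps" "length ps < 2" and b: "b \<in> points B"
    from short[OF Q] show "\<exists>a\<in>points A. Q (ps @ [(a, b)])"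
    proof (elim disjE bexE conjE)
      assume ps: "ps = []"
      from b have "point_type B b \<in> point_type A ` points A" using types by blast
      then show ?thesis using ps b unfolding Q_def by auto
    next
      fix a0 b0
      assume 0: "a0 \<in> points A" "b0 \<in> points B" "ps = [(a0, b0)]"
        "point_type A a0 = point_type B b0"
      then obtain a where a: "a \<in> points A" "order_colour_iso B A [(b0, a0), (b, a)]"
        using reply_if_point_type_eq[OF lin(2,1) _ _ b] by metis
      then have "order_colour_iso A B [(a0, b0), (a, b)]"
        using 0 b by (auto simp: order_colour_iso_pair lin)
      then show ?thesis using a 0 unfolding Q_def by auto
    qed
  next
    fix ps assume "Q ps" "length ps = 2"
    then show "order_colour_iso A B ps" unfolding Q_def by auto
  qed
qed

text \<open>
  The converse direction: II's answer to a first move \<open>b\<close> must have the type of \<open>b\<close>, since a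
  colour on one side of \<open>b\<close> or of the answer only would let I win with the second move.
\<close>

lemma types_subset_if_ef_equiv_2:
  assumes "ef_equiv 2 A B"
  shows "point_type B ` points B \<subseteq> point_type A ` points A"
proof
  fix t assume "t \<in> point_type B ` points B"
  then obtain b where b: "b \<in> points B" and t: "t = point_type B b" by blast
  from assms obtain f g where win: "winning_strategy 2 A B f g"
    unfolding ef_equiv_def by blast
  have legal: "\<forall>a\<in>points A. f ps a \<in> points B" "\<forall>b\<in>points B. g ps b \<in> points A"
    if "ps \<in> plays A B f g" "length ps < 2" for ps
    using win that unfolding winning_strategy_def by blast+
  have iso: "order_colour_iso A B ps" if "ps \<in> plays A B f g" "length ps = 2" for ps
    using win that unfolding winning_strategy_def by blast
  define a where "a = g [] b"
  have p: "[(a, b)] \<in> plays A B f g"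
    using plays.pick_right[OF plays.start b] by (simp add: a_def)
  have a: "a \<in> points A"
    using legal(2)[OF plays.start] b by (simp add: a_def)
  have pair: "col A a' = col B b' \<and> (lt A a' a \<longleftrightarrow> lt B b' b) \<and> (lt A a a' \<longleftrightarrow> lt B b b')"
    if "order_colour_iso A B [(a, b), (a', b')]" for a' b'
    using that unfolding order_colour_iso_def by simp
  have forth_step: "\<exists>b'\<in>points B. col A a' = col B b' \<and>
      (lt A a' a \<longleftrightarrow> lt B b' b) \<and> (lt A a a' \<longleftrightarrow> lt B b b')" if "a' \<in> points A" for a'
  proof (rule bexI)
    show "f [(a, b)] a' \<in> points B" using legal(1)[OF p] that by simp
  qed (use iso[OF plays.pick_left[OF p that]] in \<open>intro pair, simp\<close>)
  have back_step: "\<exists>a'\<in>points A. col A a' = col B b' \<and>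
      (lt A a' a \<longleftrightarrow> lt B b' b) \<and> (lt A a a' \<longleftrightarrow> lt B b b')" if "b' \<in> points B" for b'
  proof (rule bexI)
    show "g [(a, b)] b' \<in> points A" using legal(2)[OF p] that by simp
  qed (use iso[OF plays.pick_right[OF p that]] in \<open>intro pair, simp\<close>)
  have "col A a = col B b"
    using iso[OF plays.pick_right[OF p b]] unfolding order_colour_iso_def by simp
  moreover have "col A ` {y \<in> points A. lt A y a} = col B ` {y \<in> points B. lt B y b}"
  proof (intro equalityI subsetI)
    fix d assume "d \<in> col A ` {y \<in> points A. lt A y a}"
    then show "d \<in> col B ` {y \<in> points B. lt B y b}" using forth_step by fastforce
  next
    fix d assume "d \<in> col B ` {y \<in> points B. lt B y b}"
    then show "d \<in> col A ` {y \<in> points A. lt A y a}" using back_step by (force simp: image_iff)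
  qed
  moreover have "col A ` {y \<in> points A. lt A a y} = col B ` {y \<in> points B. lt B b y}"
  proof (intro equalityI subsetI)
    fix d assume "d \<in> col A ` {y \<in> points A. lt A a y}"
    then show "d \<in> col B ` {y \<in> points B. lt B b y}" using forth_step by fastforce
  next
    fix d assume "d \<in> col B ` {y \<in> points B. lt B b y}"
    then show "d \<in> col A ` {y \<in> points A. lt A a y}" using back_step by (force simp: image_iff)
  qed
  ultimately have "t = point_type A a" by (simp add: t point_type_def)
  with a show "t \<in> point_type A ` points A" by blast
qed

section \<open>Optimality and substrings that realise every type\<close>

text \<open>A string with pairwise distinct types meets the lower bound given by the number of types.\<close>

lemma ef_optimal_2_if_inj_on_point_type:
  assumes "finite_coloured_string A" "inj_on (point_type A) (points A)"
  shows "ef_optimal 2 A"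
proof -
  have "\<not> ef_equiv 2 C A"
    if "finite_coloured_string C" "string_length C < string_length A"
    for C :: "(nat, 'b) coloured_order"
  proof
    assume "ef_equiv 2 C A"
    then have sub: "point_type A ` points A \<subseteq> point_type C ` points C"
      by (rule types_subset_if_ef_equiv_2)
    have fin: "finite (points C)" using that by (simp add: finite_coloured_string_def)
    have "string_length A = card (point_type A ` points A)"
      using assms by (simp add: card_image)
    also have "\<dots> \<le> card (point_type C ` points C)" using sub fin by (simp add: card_mono)
    also have "\<dots> \<le> string_length C" using fin by (rule card_image_le)
    finally show False using that by simp
  qed
  with assms show ?thesis unfolding ef_optimal_def by blast
qed

text \<open>
  If \<open>z\<close> and \<open>w\<close> have the same colour \<open>c\<close> and \<open>z\<close> is below \<open>w\<close>, then \<open>c\<close> occurs below \<open>w\<close>. So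
  if \<open>z\<close> is the first point of colour \<open>c\<close>, no other point has its type.
\<close>

lemma first_of_colour_point_type_unique:
  assumes lin: "coloured_linear_order A" and z: "z \<in> points A" and w: "w \<in> points A"
    and first: "\<And>y. y \<in> points A \<Longrightarrow> col A y = col A z \<Longrightarrow> \<not> lt A y z"
    and eq: "point_type A w = point_type A z"
  shows "w = z"
proof (rule ccontr)
  assume "w \<noteq> z"
  have col: "col A w = col A z" using eq by (simp add: point_type_def)
  with first w have "\<not> lt A w z" by blast
  then have "lt A z w"
    using coloured_linear_order_total[OF lin z w] \<open>w \<noteq> z\<close> by blast
  then have "col A z \<in> col A ` {y \<in> points A. lt A y w}" using z by blast
  then have "col A z \<in> col A ` {y \<in> points A. lt A y z}" using eq by (simp add: point_type_def)
  with first show False by auto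
qed

lemma last_of_colour_point_type_unique:
  assumes lin: "coloured_linear_order A" and z: "z \<in> points A" and w: "w \<in> points A"
    and last: "\<And>y. y \<in> points A \<Longrightarrow> col A y = col A z \<Longrightarrow> \<not> lt A z y"
    and eq: "point_type A w = point_type A z"
  shows "w = z"
proof (rule ccontr)
  assume "w \<noteq> z"
  have col: "col A w = col A z" using eq by (simp add: point_type_def)
  with last w have "\<not> lt A z w" by blast
  then have "lt A w z"
    using coloured_linear_order_total[OF lin z w] \<open>w \<noteq> z\<close> by blast
  then have "col A z \<in> col A ` {y \<in> points A. lt A w y}" using z by blast
  then have "col A z \<in> col A ` {y \<in> points A. lt A z y}" using eq by (simp add: point_type_def)
  with last show False by auto
qed

text \<open>
  A set \<open>S\<close> that meets every type contains the first and the last point of every colour, so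
  dropping the points outside \<open>S\<close> removes no colour from either side of any point.
\<close>

lemma point_type_restrict:
  assumes A: "finite_coloured_string A" and S: "S \<subseteq> points A"
    and types: "point_type A ` S = point_type A ` points A" and x: "x \<in> points A"
  shows "point_type (A\<lparr>points := S\<rparr>) x = point_type A x"
proof -
  have lin: "coloured_linear_order A" and fin: "finite (points A)"
    using A by (simp_all add: finite_coloured_string_def)
  have asym: "asymp_on (points A) (lt A)" and trans: "transp_on (points A) (lt A)"
    using lin coloured_linear_order_asym[OF lin]
    by (simp_all add: coloured_linear_order_def asymp_on_def)
  have irr: "\<not> lt A u u" if "u \<in> points A" for u
    using asymp_onD[OF asym that that] by blast
  have cmp: "lt A u v"
    if "u \<in> points A" "v \<in> points A" "y \<in> points A" "lt A u y" "lt A y v" for u v y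
    by (rule transp_onD[OF trans that(1,3,2,4,5)])
  note tot = coloured_linear_order_total[OF lin]
  have below: "\<exists>z\<in>S. lt A z x \<and> col A z = col A y" if y: "y \<in> points A" "lt A y x" for y
  proof -
    let ?M = "{z \<in> points A. col A z = col A y}"
    have "\<exists>z\<in>?M. \<forall>w\<in>?M. w \<noteq> z \<longrightarrow> \<not> lt A w z"
      by (rule Finite_Set.bex_min_element)
        (use fin y in \<open>auto intro: asymp_on_subset[OF asym] transp_on_subset[OF trans]\<close>)
    then obtain z where z: "z \<in> points A" "col A z = col A y"
      and extremal: "\<forall>w\<in>?M. w \<noteq> z \<longrightarrow> \<not> lt A w z" by blast
    have first: "\<not> lt A w z" if "w \<in> points A" "col A w = col A y" for w
      using extremal irr that by (cases "w = z") simp_all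
    from z have "point_type A z \<in> point_type A ` S" unfolding types by blast
    then obtain s where s: "s \<in> S" "point_type A s = point_type A z" by force
    have "s = z"
      by (rule first_of_colour_point_type_unique[OF lin z(1)]) (use S s z first in auto)
    moreover have "lt A z x"
    proof (cases "y = z")
      case False
      with tot[OF z(1) y(1)] first[OF y(1)] have "lt A z y" by blast
      then show ?thesis using cmp z(1) x y by blast
    qed (use y in simp)
    ultimately show ?thesis using s z by blast
  qed
  have above: "\<exists>z\<in>S. lt A x z \<and> col A z = col A y" if y: "y \<in> points A" "lt A x y" for y
  proof -
    let ?M = "{z \<in> points A. col A z = col A y}"
    have "\<exists>z\<in>?M. \<forall>w\<in>?M. w \<noteq> z \<longrightarrow> \<not> lt A z w"
      by (rule Finite_Set.bex_max_element)
        (use fin y in \<open>auto intro: asymp_on_subset[OF asym] transp_on_subset[OF trans]\<close>)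
    then obtain z where z: "z \<in> points A" "col A z = col A y"
      and extremal: "\<forall>w\<in>?M. w \<noteq> z \<longrightarrow> \<not> lt A z w" by blast
    have last: "\<not> lt A z w" if "w \<in> points A" "col A w = col A y" for w
      using extremal irr that by (cases "w = z") simp_all
    from z have "point_type A z \<in> point_type A ` S" unfolding types by blast
    then obtain s where s: "s \<in> S" "point_type A s = point_type A z" by force
    have "s = z"
      by (rule last_of_colour_point_type_unique[OF lin z(1)]) (use S s z last in auto)
    moreover have "lt A x z"
    proof (cases "y = z")
      case False
      with tot[OF z(1) y(1)] last[OF y(1)] have "lt A y z" by blast
      then show ?thesis using cmp x z(1) y by blast
    qed (use y in simp)
    ultimately show ?thesis using s z by blast
  qed
  have "col A ` {y \<in> S. lt A y x} = col A ` {y \<in> points A. lt A y x}"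
  proof (intro equalityI subsetI)
    fix d assume "d \<in> col A ` {y \<in> points A. lt A y x}"
    then obtain y where "y \<in> points A" "lt A y x" "d = col A y" by blast
    with below[of y] obtain z where "z \<in> S" "lt A z x" "d = col A z" by auto
    then show "d \<in> col A ` {y \<in> S. lt A y x}" by blast
  qed (use S in blast)
  moreover have "col A ` {y \<in> S. lt A x y} = col A ` {y \<in> points A. lt A x y}"
  proof (intro equalityI subsetI)
    fix d assume "d \<in> col A ` {y \<in> points A. lt A x y}"
    then obtain y where "y \<in> points A" "lt A x y" "d = col A y" by blast
    with above[of y] obtain z where "z \<in> S" "lt A x z" "d = col A z" by auto
    then show "d \<in> col A ` {y \<in> S. lt A x y}" by blast
  qed (use S in blast)
  ultimately show ?thesis by (simp add: point_type_def)
qed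

lemma finite_coloured_string_restrict:
  assumes "finite_coloured_string A" "S \<subseteq> points A"
  shows "finite_coloured_string (A\<lparr>points := S\<rparr>)"
  using assms unfolding finite_coloured_string_def coloured_linear_order_def
  by (auto intro: irreflp_on_subset transp_on_subset totalp_on_subset finite_subset)

theorem theorem2p4:
  fixes A :: "('a, 'c) coloured_order"
  assumes "finite_coloured_string A"
  shows "\<exists>B :: ('a, 'c) coloured_order. substring B A \<and> ef_equiv 2 B A \<and> ef_optimal 2 B"
proof -
  \<comment> \<open>\<open>S\<close> consists of one representative of each type.\<close>
  obtain S where S: "S \<subseteq> points A" and inj: "inj_on (point_type A) S"
    and types: "point_type A ` S = point_type A ` points A"
    using subset_image_inj[of "point_type A ` points A" "point_type A" "points A"] by auto
  define B where "B = A\<lparr>points := S\<rparr>"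
  have points_B: "points B = S" by (simp add: B_def)
  have type_B: "point_type B x = point_type A x" if "x \<in> S" for x
    using point_type_restrict[OF assms S types] that S unfolding B_def by blast
  have B: "finite_coloured_string B"
    unfolding B_def by (rule finite_coloured_string_restrict[OF assms S])
  have "substring B A" using S by (simp add: substring_def B_def)
  moreover have "ef_equiv 2 B A"
    using B assms types type_B
    by (intro ef_equiv_2_if_types_eq) (simp_all add: finite_coloured_string_def points_B)
  moreover have "inj_on (point_type B) (points B)"
    using inj type_B by (simp add: points_B inj_on_def)
  then have "ef_optimal 2 B" by (rule ef_optimal_2_if_inj_on_point_type[OF B])
  ultimately show ?thesis by blast
qed

end
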